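(* Let $E$ be a Banach space, $\mathcal D$ a domain in $E$, and $\Phi^X_t$ a dynamical system on $E$ with vector field $X:\mathcal D\to E$. Let $F\in C^2(E,\mathbb R^m)$ be a vector of constants of the motion for $\Phi_t^X$ with level sets $\Sigma_\mu=\{u\in E\mid F(u)=\mu\}$, and let $G$ be an invariance group of $\Phi_t^X$, with action $\Phi$ on $E$. Let $\mu_*\in\mathbb R^m$ and put $G_{\Sigma_{\mu_*}}=\{g\in G\mid\Phi_g\Sigma_{\mu_*}=\Sigma_{\mu_*}\}$. Suppose there exist: $u_{\mu_*}\in\Sigma_{\mu_*}$ which is a relative equilibrium of the dynamics for the group $G_{\Sigma_{\mu_*}}$; a $G_{\Sigma_{\mu_*}}$-invariant constant of the motion $\mathcal L_{\mu_*}\in C(E,\mathbb R)$; and $\eta>0$, $c>0$ such that, with $\mathcal O_{u_{\mu_*}}=\{\Phi_g(u_{\mu_*})\mid g\in G_{\Sigma_{\mu_*}}\}$, $$\forall u\in\mathcal O_{u_{\mu_*}},\ \forall u'\in\Sigma_{\mu_*},\quad \mathrm d(u,u')\le\eta\ \Rightarrow\ \mathcal L_{\mu_*}(u')-\mathcal L_{\mu_*}(u)\ge c\,\mathrm d^2(u',\mathcal O_{u_{\mu_*}}).$$ Then $$\forall u\in\mathcal O_{u_{\mu_*}},\ \forall\epsilon>0,\ \exists\delta>0,\ \Big(\forall u'\in\Sigma_{\mu_*},\ \mathrm d(u',u)\le\delta\Rightarrow\sup_{t\in\mathbb R}\mathrm d(u'(t),\mathcal O_{u_{\mu_*}})\le\epsilon\Big).$$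 If in addition (i) $\mathcal L_{\mu_*}$ is uniformly continuous on bounded sets, (ii) $\mathcal O_{u_{\mu_*}}$ is bounded, (iii) for every bounded sequence $(u_n)$ in $E$, $\lim_nF(u_n)=\mu_*$ implies $\mathrm d(u_n,\Sigma_{\mu_*})\to0$, then all $u\in\mathcal O_{u_{\mu_*}}$ are orbitally stable $G_{\Sigma_{\mu_*}}$-relative equilibria.
   Context: A domain $\mathcal D$ in $E$ is a dense subset of $E$. A dynamical system on $E$ with vector field $X:\mathcal D\to E$ is a separately continuous map $\Phi^X:\mathbb R\times E\to E$, $(t,u)\mapsto\Phi_t^X(u)$, with $\Phi_t^X\circ\Phi_s^X=\Phi_{t+s}^X$, $\Phi_0^X=\mathrm{Id}_E$, $\Phi_t^X(\mathcal D)=\mathcal D$, and such that for $u\in\mathcal D$ the curve $u(t)=\Phi_t^X(u)$ is differentiable as a map $\mathbb R\to E$ and satisfies $\dot u(t)=X(u(t))$, $u(0)=u$. For any $v\in E$ one writes $v(t)=\Phi_t^X(v)$. A function $F$ on $E$ is a constant of the motion if $F\circ\Phi_t^X=F$ for all $t\in\mathbb R$ (for vector-valued $F$, each component). An action of a topological group $G$ on $E$ is a separately continuous map $(g,u)\mapsto\Phi_g(u)$ with $\Phi_e=\mathrm{Id}$, $\Phi_{g_1g_2}=\Phi_{g_1}\circ\Phi_{g_2}$; $G$ is an invariance group for $\Phi_t^X$ if $\Phi_g\circ\Phi_t^X=\Phi_t^X\circ\Phi_g$ for all $g\in G$, $t\in\mathbb R$. $\mathrm d(u,v)=\|u-v\|$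 and $\mathrm d(u,S)=\inf_{v\in S}\mathrm d(u,v)$. For a subgroup $\tilde G\subset G$ and $u\in E$, let $\mathcal O_u=\{\Phi_g(u)\mid g\in\tilde G\}$. $u$ is a $\tilde G$-relative equilibrium if $u(t)\in\mathcal O_u$ for all $t\in\mathbb R$. $u$ is orbitally stable (with respect to $\tilde G$) if for all $\epsilon>0$ there is $\delta>0$ such that for all $v\in E$: $\mathrm d(v,u)\le\delta\Rightarrow\forall t\in\mathbb R,\ \inf_{t'\in\mathbb R}\mathrm d(v(t),\mathcal O_{u(t')})\le\epsilon$. (Here $\tilde G=G_{\Sigma_{\mu_*}}$.) *)

theory Defs
  imports "HOL-Analysis.Analysis"
begin

text \<open>The field \<open>X\<close> is a total function, but only its values on \<open>D\<close> matter.\<close>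

definition dynamical_system ::
    "'e::real_normed_vector set \<Rightarrow> ('e \<Rightarrow> 'e) \<Rightarrow> (real \<Rightarrow> 'e \<Rightarrow> 'e) \<Rightarrow> bool" where
  "dynamical_system D X \<Phi> \<longleftrightarrow>
     closure D = UNIV \<and>
     (\<forall>t. continuous_on UNIV (\<Phi> t)) \<and>
     (\<forall>u. continuous_on UNIV (\<lambda>t. \<Phi> t u)) \<and>
     (\<forall>t s. \<Phi> t \<circ> \<Phi> s = \<Phi> (t + s)) \<and>
     \<Phi> 0 = id \<and>
     (\<forall>t. \<Phi> t ` D = D) \<and>
     (\<forall>u\<in>D. \<forall>t. ((\<lambda>s. \<Phi> s u) has_vector_derivative X (\<Phi> t u)) (at t))"

definition constant_of_motion :: "(real \<Rightarrow> 'e \<Rightarrow> 'e) \<Rightarrow> ('e \<Rightarrow> 'b) \<Rightarrow> bool" where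
  "constant_of_motion \<Phi> F \<longleftrightarrow> (\<forall>t. F \<circ> \<Phi> t = F)"

text \<open>The class \<^class>\<open>topological_group_add\<close> is used as the class of arbitrary topological
  groups, written additively: \<^class>\<open>group_add\<close> does not assume commutativity, and no
  separation axiom is imposed on the topology. Thus \<open>0\<close> is the neutral element \<open>e\<close>, and
  \<open>g + h\<close> is the product \<open>gh\<close>.\<close>

definition topological_action ::
    "('g::topological_group_add \<Rightarrow> 'e::topological_space \<Rightarrow> 'e) \<Rightarrow> bool" where
  "topological_action \<phi> \<longleftrightarrow>
     (\<forall>g. continuous_on UNIV (\<phi> g)) \<and>
     (\<forall>u. continuous_on UNIV (\<lambda>g. \<phi> g u)) \<and>
     \<phi> 0 = id \<and>
     (\<forall>g h. \<phi> (g + h) = \<phi> g \<circ> \<phi> h)"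

definition invariance_group ::
    "('g::topological_group_add \<Rightarrow> 'e::topological_space \<Rightarrow> 'e) \<Rightarrow> (real \<Rightarrow> 'e \<Rightarrow> 'e) \<Rightarrow> bool" where
  "invariance_group \<phi> \<Phi> \<longleftrightarrow>
     topological_action \<phi> \<and> (\<forall>g t. \<phi> g \<circ> \<Phi> t = \<Phi> t \<circ> \<phi> g)"

definition level_set :: "('e \<Rightarrow> 'b) \<Rightarrow> 'b \<Rightarrow> 'e set" where
  "level_set F \<mu> = {u. F u = \<mu>}"

definition set_stabilizer :: "('g \<Rightarrow> 'e \<Rightarrow> 'e) \<Rightarrow> 'e set \<Rightarrow> 'g set" where
  "set_stabilizer \<phi> S = {g. \<phi> g ` S = S}"

lemma set_stabilizer_subgroup:
  fixes \<phi> :: "'g::topological_group_add \<Rightarrow> 'e::topological_space \<Rightarrow> 'e"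
  assumes "topological_action \<phi>"
  shows "0 \<in> set_stabilizer \<phi> S"
    and "g \<in> set_stabilizer \<phi> S \<Longrightarrow> h \<in> set_stabilizer \<phi> S \<Longrightarrow> g + h \<in> set_stabilizer \<phi> S"
    and "g \<in> set_stabilizer \<phi> S \<Longrightarrow> - g \<in> set_stabilizer \<phi> S"
proof -
  have zero: "\<phi> 0 = id" and add: "\<phi> (g + h) = \<phi> g \<circ> \<phi> h" for g h
    using assms by (auto simp: topological_action_def)
  show "0 \<in> set_stabilizer \<phi> S"
    by (simp add: set_stabilizer_def zero)
  show "g + h \<in> set_stabilizer \<phi> S"
    if "g \<in> set_stabilizer \<phi> S" "h \<in> set_stabilizer \<phi> S"
  proof -
    have "\<phi> (g + h) ` S = \<phi> g ` \<phi> h ` S"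
      by (simp only: add image_comp)
    then show ?thesis
      using that by (simp add: set_stabilizer_def)
  qed
  show "- g \<in> set_stabilizer \<phi> S" if "g \<in> set_stabilizer \<phi> S"
  proof -
    have "\<phi> (- g) ` S = \<phi> (- g) ` \<phi> g ` S"
      using that by (simp add: set_stabilizer_def)
    also have "\<dots> = \<phi> (- g + g) ` S"
      by (simp only: add image_comp)
    also have "\<dots> = S"
      by (simp add: zero)
    finally show ?thesis
      by (simp add: set_stabilizer_def)
  qed
qed

definition orbit :: "('g \<Rightarrow> 'e \<Rightarrow> 'e) \<Rightarrow> 'g set \<Rightarrow> 'e \<Rightarrow> 'e set" where
  "orbit \<phi> H u = {\<phi> g u | g. g \<in> H}"

definition relative_equilibrium ::
    "('g \<Rightarrow> 'e \<Rightarrow> 'e) \<Rightarrow> 'g set \<Rightarrow> (real \<Rightarrow> 'e \<Rightarrow> 'e) \<Rightarrow> 'e \<Rightarrow> bool" where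
  "relative_equilibrium \<phi> H \<Phi> u \<longleftrightarrow> (\<forall>t. \<Phi> t u \<in> orbit \<phi> H u)"

definition orbitally_stable ::
    "('g \<Rightarrow> 'e::real_normed_vector \<Rightarrow> 'e) \<Rightarrow> 'g set \<Rightarrow> (real \<Rightarrow> 'e \<Rightarrow> 'e) \<Rightarrow> 'e \<Rightarrow> bool" where
  "orbitally_stable \<phi> H \<Phi> u \<longleftrightarrow>
     (\<forall>\<epsilon>>0. \<exists>\<delta>>0. \<forall>v. dist v u \<le> \<delta> \<longrightarrow>
        (\<forall>t. (INF t'. infdist (\<Phi> t v) (orbit \<phi> H (\<Phi> t' u))) \<le> \<epsilon>))"

definition C2_function :: "('e::real_normed_vector \<Rightarrow> 'b::real_normed_vector) \<Rightarrow> bool" where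
  "C2_function F \<longleftrightarrow>
     (\<exists>(F' :: 'e \<Rightarrow> 'e \<Rightarrow>\<^sub>L 'b) (F'' :: 'e \<Rightarrow> 'e \<Rightarrow>\<^sub>L ('e \<Rightarrow>\<^sub>L 'b)).
        (\<forall>u. (F has_derivative blinfun_apply (F' u)) (at u)) \<and>
        (\<forall>u. (F' has_derivative blinfun_apply (F'' u)) (at u)) \<and>
        continuous_on UNIV F'')"

end

theory Submission
  imports Defs
begin

text \<open>The function \<open>L\<close> is constant along the orbit \<open>\<O>\<close> and along the motion, and the
  coercivity bound says that on \<open>\<Sigma>\<close>, at a small distance \<open>r\<close> from \<open>\<O>\<close>, it exceeds its value on
  \<open>\<O>\<close> by at least \<open>c r\<^sup>2\<close>. A motion in \<open>\<Sigma>\<close> that starts close to \<open>\<O>\<close> has too small a value of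
  \<open>L\<close> to be ever at distance exactly \<open>r\<close>, so by the intermediate value theorem it stays closer.
  For initial data off \<open>\<Sigma>\<close>, a sequence of motions violating stability passes through points at
  distance exactly \<open>r\<close>. These points form a bounded sequence on which \<open>F\<close> tends to \<open>\<mu>\<close>, so they
  are asymptotic to points of \<open>\<Sigma>\<close>, where uniform continuity of \<open>L\<close> contradicts coercivity.\<close>

section \<open>Orbits under a set stabilizer\<close>

text \<open>Orbits of a group partition the space. This lets the orbits through the points
  \<open>\<Phi> t' u\<close> in \<open>orbitally_stable\<close> be replaced by one fixed
  set.\<close>

lemma orbit_set_stabilizer_eq:
  fixes \<phi> :: "'g::topological_group_add \<Rightarrow> 'e::topological_space \<Rightarrow> 'e"
  assumes act: "topological_action \<phi>"
    and v: "v \<in> orbit \<phi> (set_stabilizer \<phi> S) u"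
  shows "orbit \<phi> (set_stabilizer \<phi> S) v = orbit \<phi> (set_stabilizer \<phi> S) u"
proof -
  have add: "\<phi> (a + b) x = \<phi> a (\<phi> b x)" for a b x
    using act by (simp add: topological_action_def)
  obtain g where g: "g \<in> set_stabilizer \<phi> S" and vg: "v = \<phi> g u"
    using v by (auto simp: orbit_def)
  note sub = set_stabilizer_subgroup[OF act]
  show ?thesis
  proof
    show "orbit \<phi> (set_stabilizer \<phi> S) v \<subseteq> orbit \<phi> (set_stabilizer \<phi> S) u"
      using sub(2)[OF _ g] by (auto simp: orbit_def vg simp flip: add)
    show "orbit \<phi> (set_stabilizer \<phi> S) u \<subseteq> orbit \<phi> (set_stabilizer \<phi> S) v"
    proof
      fix w assume "w \<in> orbit \<phi> (set_stabilizer \<phi> S) u"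
      then obtain h where h: "h \<in> set_stabilizer \<phi> S" "w = \<phi> h u"
        by (auto simp: orbit_def)
      then have "w = \<phi> (h + - g) v"
        by (simp add: vg add.assoc flip: add)
      then show "w \<in> orbit \<phi> (set_stabilizer \<phi> S) v"
        using sub(2)[OF h(1) sub(3)[OF g]] by (auto simp: orbit_def)
    qed
  qed
qed

text \<open>The flow commutes with the action: if \<Phi> moves \<open>u\<close> by \<open>h\<close>,
  then it takes \<open>\<phi> g u\<close> to \<open>\<phi> (g + h) u\<close>, which lies in the same
  orbit.\<close>

lemma relative_equilibrium_orbit:
  fixes \<phi> :: "'g::topological_group_add \<Rightarrow> 'e::topological_space \<Rightarrow> 'e"
  assumes inv: "invariance_group \<phi> \<Phi>"
    and eq: "relative_equilibrium \<phi> (set_stabilizer \<phi> S) \<Phi> u"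
    and v: "v \<in> orbit \<phi> (set_stabilizer \<phi> S) u"
  shows "relative_equilibrium \<phi> (set_stabilizer \<phi> S) \<Phi> v"
  unfolding relative_equilibrium_def
proof
  fix t
  have act: "topological_action \<phi>" and comm: "\<phi> g (\<Phi> t x) = \<Phi> t (\<phi> g x)" for g x
    using inv unfolding invariance_group_def by (simp, metis comp_apply)
  have add: "\<phi> (a + b) x = \<phi> a (\<phi> b x)" for a b x
    using act by (simp add: topological_action_def)
  obtain g where g: "g \<in> set_stabilizer \<phi> S" "v = \<phi> g u"
    using v by (auto simp: orbit_def)
  obtain h where h: "h \<in> set_stabilizer \<phi> S" "\<Phi> t u = \<phi> h u"
    using eq by (auto simp: orbit_def relative_equilibrium_def)
  have "\<Phi> t v = \<phi> (g + h) u"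
    using g h by (simp add: add flip: comm)
  then have "\<Phi> t v \<in> orbit \<phi> (set_stabilizer \<phi> S) u"
    using set_stabilizer_subgroup(2)[OF act g(1) h(1)] by (auto simp: orbit_def)
  then show "\<Phi> t v \<in> orbit \<phi> (set_stabilizer \<phi> S) v"
    using orbit_set_stabilizer_eq[OF act v] by simp
qed

section \<open>Distance to a set along a curve\<close>

text \<open>The distance to \<open>A\<close> is continuous along the curve, so its values form an
  interval. No order between \<open>a\<close> and \<open>b\<close> is assumed, so positive and
  negative times are treated alike.\<close>

lemma infdist_curve_hits:
  fixes x :: "real \<Rightarrow> 'e::metric_space"
  assumes "continuous_on UNIV x" and "infdist (x a) A \<le> r" and "r \<le> infdist (x b) A"
  obtains t where "infdist (x t) A = r"
proof -
  have "connected (range (\<lambda>t. infdist (x t) A))"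
    using assms(1) by (intro connected_continuous_image continuous_on_infdist) auto
  then have "r \<in> range (\<lambda>t. infdist (x t) A)"
    by (rule connectedD_interval) (use assms in auto)
  then show ?thesis
    using that by auto
qed

text \<open>The infimum need not be attained, but a strict bound on it passes to some point of
  \<open>A\<close>. Nonemptiness excludes the convention that \<open>infdist\<close> to the empty
  set is 0.\<close>

lemma infdist_lessD:
  assumes "A \<noteq> {}" and "infdist x A < e"
  obtains a where "a \<in> A" and "dist x a < e"
  using assms infdist_notempty[of A x] cInf_lessD[of "dist x ` A" e] by auto

section \<open>Stability from a coercive conserved quantity\<close>

lemma stable_within_level_set:
  fixes \<Phi> :: "real \<Rightarrow> 'e::metric_space \<Rightarrow> 'e" and L :: "'e \<Rightarrow> real"
  assumes zero: "\<Phi> 0 = id"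
    and cont: "\<And>x. continuous_on UNIV (\<lambda>t. \<Phi> t x)"
    and inv: "\<And>t x. x \<in> S \<Longrightarrow> \<Phi> t x \<in> S"
    and L_cont: "continuous_on UNIV L"
    and L_const: "\<And>t x. L (\<Phi> t x) = L x"
    and L_orbit: "\<And>x. x \<in> A \<Longrightarrow> L x = l"
    and pos: "0 < \<eta>" "0 < c"
    and coercive: "\<And>x y. x \<in> A \<Longrightarrow> y \<in> S \<Longrightarrow> dist x y \<le> \<eta> \<Longrightarrow> c * (infdist y A)\<^sup>2 \<le> L y - L x"
    and u: "u \<in> A" and \<epsilon>: "0 < \<epsilon>"
  shows "\<exists>\<delta>>0. \<forall>v\<in>S. dist v u \<le> \<delta> \<longrightarrow> (\<forall>t. infdist (\<Phi> t v) A \<le> \<epsilon>)"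
proof -
  \<comment> \<open>Halving \<eta> gives \<open>r < \<eta>\<close>, so a point at distance exactly
    \<open>r\<close> from \<open>A\<close> has a point of \<open>A\<close> within \<eta>, as
    coercivity requires.\<close>
  define r where "r = min \<epsilon> (\<eta> / 2)"
  have r: "0 < r" "r \<le> \<epsilon>" "r < \<eta>"
    using \<epsilon> pos by (auto simp: r_def)
  have "0 < c * r\<^sup>2"
    using r pos by simp
  then obtain d where d: "0 < d" "\<And>v. dist v u < d \<Longrightarrow> dist (L v) (L u) < c * r\<^sup>2"
    using L_cont unfolding continuous_on_iff by (metis UNIV_I)
  \<comment> \<open>In the choice of \<delta>, \<open>d / 2\<close> yields the strict bound needed
    for continuity of \<open>L\<close> at \<open>u\<close>, and \<open>r\<close> makes the motion
    start within \<open>r\<close> of \<open>A\<close>.\<close>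
  have "infdist (\<Phi> t v) A \<le> \<epsilon>" if v: "v \<in> S" "dist v u \<le> min (d / 2) r" for v t
  proof (rule ccontr)
    assume "\<not> ?thesis"
    then have far: "r \<le> infdist (\<Phi> t v) A"
      using r by simp
    have near: "infdist (\<Phi> 0 v) A \<le> r"
      using v infdist_le[OF u, of v] by (simp add: zero)
    obtain s where s: "infdist (\<Phi> s v) A = r"
      using infdist_curve_hits[OF cont near far] .
    then obtain a where a: "a \<in> A" "dist (\<Phi> s v) a < \<eta>"
      using infdist_lessD[of A "\<Phi> s v" \<eta>] u r by auto
    then have "c * r\<^sup>2 \<le> L (\<Phi> s v) - L a"
      using coercive[OF a(1) inv[OF v(1), of s]] s by (simp add: dist_commute)
    \<comment> \<open>Conservation of \<open>L\<close> moves the estimate back to time 0, and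
      constancy of \<open>L\<close> on \<open>A\<close> replaces \<open>a\<close> by
      \<open>u\<close>.\<close>
    then have "c * r\<^sup>2 \<le> L v - L u"
      using a u L_orbit L_const by simp
    moreover have "dist (L v) (L u) < c * r\<^sup>2"
      using v d by simp
    ultimately show False
      by (simp add: dist_real_def)
  qed
  then show ?thesis
    using d r by (intro exI[of _ "min (d / 2) r"]) auto
qed

text \<open>Coercivity speaks only of points of the level set, so the crossing points at distance
  \<open>r\<close> are first replaced by nearby points there. Since \<open>approach\<close> is a
  statement about sequences, \<delta> is obtained by contradiction.\<close>

lemma stable_near_level_set:
  fixes \<Phi> :: "real \<Rightarrow> 'e::metric_space \<Rightarrow> 'e" and L :: "'e \<Rightarrow> real" and F :: "'e \<Rightarrow> 'b::metric_space"
  assumes zero: "\<Phi> 0 = id"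
    and cont: "\<And>x. continuous_on UNIV (\<lambda>t. \<Phi> t x)"
    and F_cont: "continuous_on UNIV F"
    and F_const: "\<And>t x. F (\<Phi> t x) = F x"
    and L_cont: "continuous_on UNIV L"
    and L_const: "\<And>t x. L (\<Phi> t x) = L x"
    and L_orbit: "\<And>x. x \<in> A \<Longrightarrow> L x = l"
    and A_level: "A \<subseteq> level_set F \<mu>"
    and pos: "0 < \<eta>" "0 < c"
    and coercive: "\<And>x y. x \<in> A \<Longrightarrow> y \<in> level_set F \<mu> \<Longrightarrow> dist x y \<le> \<eta> \<Longrightarrow>
                     c * (infdist y A)\<^sup>2 \<le> L y - L x"
    and unif: "\<And>B. bounded B \<Longrightarrow> uniformly_continuous_on B L"
    and bdd: "bounded A"
    and approach: "\<And>w :: nat \<Rightarrow> 'e. bounded (range w) \<Longrightarrow> (\<lambda>n. F (w n)) \<longlonglongrightarrow> \<mu> \<Longrightarrow>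
                     (\<lambda>n. infdist (w n) (level_set F \<mu>)) \<longlonglongrightarrow> 0"
    and u: "u \<in> A" and \<epsilon>: "0 < \<epsilon>"
  shows "\<exists>\<delta>>0. \<forall>v. dist v u \<le> \<delta> \<longrightarrow> (\<forall>t. infdist (\<Phi> t v) A \<le> \<epsilon>)"
proof (rule ccontr)
  assume unstable: "\<not> ?thesis"
  let ?S = "level_set F \<mu>"
  define r where "r = min \<epsilon> (\<eta> / 2)"
  have r: "0 < r" "r \<le> \<epsilon>" "r < \<eta>"
    using \<epsilon> pos by (auto simp: r_def)
  \<comment> \<open>Instability is used with \<delta> equal to \<open>r / real (Suc n)\<close>: it
    tends to 0 and never exceeds \<open>r\<close>, so each motion starts within \<open>r\<close> of
    \<open>A\<close> and must cross distance \<open>r\<close>.\<close>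
  have "\<exists>v s. dist v u \<le> r / real (Suc n) \<and> infdist (\<Phi> s v) A = r" for n
  proof -
    have "0 < r / real (Suc n)"
      using r by simp
    then obtain v t where v: "dist v u \<le> r / real (Suc n)" and t: "\<epsilon> < infdist (\<Phi> t v) A"
      using unstable by (meson not_le)
    have "r / real (Suc n) \<le> r"
      using r by (simp add: divide_le_eq)
    then have near: "infdist (\<Phi> 0 v) A \<le> r"
      using v infdist_le[OF u, of v] by (simp add: zero)
    have far: "r \<le> infdist (\<Phi> t v) A"
      using t r by simp
    show ?thesis
      using infdist_curve_hits[OF cont near far] v by metis
  qed
  then obtain v s where v: "\<And>n. dist (v n) u \<le> r / real (Suc n)"
    and s: "\<And>n. infdist (\<Phi> (s n) (v n)) A = r"
    by metis
  define w where "w n = \<Phi> (s n) (v n)" for n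
  have "(\<lambda>n. r / real (Suc n)) \<longlonglongrightarrow> 0"
    using LIMSEQ_Suc[OF lim_const_over_n[of r]] by simp
  then have v_lim: "v \<longlonglongrightarrow> u"
    by (rule metric_tendsto_imp_tendsto) (intro always_eventually allI order_trans[OF v], use r in simp)
  \<comment> \<open>Nothing is known about the times \<open>s n\<close>, but \<open>F\<close> and
    \<open>L\<close> take the same values at \<open>w n\<close> as at \<open>v n\<close>, and
    \<open>v n\<close> tends to \<open>u\<close>.\<close>
  have "F u = \<mu>"
    using u A_level by (auto simp: level_set_def)
  moreover have "(\<lambda>n. F (v n)) \<longlonglongrightarrow> F u"
    using continuous_on_tendsto_compose[OF F_cont v_lim] by simp
  ultimately have F_lim: "(\<lambda>n. F (w n)) \<longlonglongrightarrow> \<mu>"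
    by (simp add: w_def F_const)
  have L_lim: "(\<lambda>n. L (w n)) \<longlonglongrightarrow> l"
    using continuous_on_tendsto_compose[OF L_cont v_lim] by (simp add: w_def L_const L_orbit[OF u])
  obtain R where R: "\<And>a. a \<in> A \<Longrightarrow> dist u a \<le> R"
    using bdd bounded_any_center[of A u] by blast
  have w_bdd: "dist u (w n) \<le> R + \<eta>" for n
  proof -
    obtain a where "a \<in> A" "dist (w n) a < \<eta>"
      using infdist_lessD[of A "w n" \<eta>] u r s[of n] by (auto simp: w_def)
    then show ?thesis
      using R[of a] dist_triangle[of u "w n" a] by (simp add: dist_commute)
  qed
  have S_lim: "(\<lambda>n. infdist (w n) ?S) \<longlonglongrightarrow> 0"
    using w_bdd by (intro approach F_lim) (auto simp: bounded_def)
  \<comment> \<open>A nearest point of the level set need not exist; the positive slack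
    \<open>r / real (Suc n)\<close> allows an almost nearest one and vanishes in the limit.\<close>
  have "\<exists>z\<in>?S. dist (w n) z < infdist (w n) ?S + r / real (Suc n)" for n
    using infdist_lessD[of ?S "w n" "infdist (w n) ?S + r / real (Suc n)"] u A_level r by force
  then obtain z where z: "\<And>n. z n \<in> ?S"
    and wz: "\<And>n. dist (w n) (z n) < infdist (w n) ?S + r / real (Suc n)"
    by metis
  have "(\<lambda>n. infdist (w n) ?S + r / real (Suc n)) \<longlonglongrightarrow> 0"
    using tendsto_add[OF S_lim \<open>(\<lambda>n. r / real (Suc n)) \<longlonglongrightarrow> 0\<close>] by simp
  then have wz_lim: "(\<lambda>n. dist (w n) (z n)) \<longlonglongrightarrow> 0"
    by (rule tendsto_sandwich[rotated 2, OF tendsto_const])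
      (use wz in \<open>auto intro!: always_eventually less_imp_le\<close>)
  \<comment> \<open>One ball for both sequences: \<open>w n\<close> is within
    \<open>R + \<eta>\<close> of \<open>u\<close>. As \<open>A\<close> lies in the level set,
    \<open>w n\<close> is at most \<open>r\<close> from the latter, and the slack adds at most
    another \<open>r\<close> for \<open>z n\<close>.\<close>
  define B where "B = cball u (R + \<eta> + 2 * r)"
  have wB: "w n \<in> B" for n
    using w_bdd[of n] r by (simp add: B_def)
  have zB: "z n \<in> B" for n
  proof -
    have "infdist (w n) ?S \<le> r"
      using infdist_mono[OF A_level, of "w n"] u s[of n] by (auto simp: w_def)
    moreover have "r / real (Suc n) \<le> r"
      using r by (simp add: divide_le_eq)
    ultimately have "dist (w n) (z n) \<le> 2 * r"
      using wz[of n] by linarith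
    then show ?thesis
      using w_bdd[of n] dist_triangle[of u "z n" "w n"] by (simp add: B_def)
  qed
  have "uniformly_continuous_on B L"
    by (simp add: unif B_def)
  then have "(\<lambda>n. dist (L (w n)) (L (z n))) \<longlonglongrightarrow> 0"
    using wB zB wz_lim unfolding uniformly_continuous_on_sequentially by blast
  then have "(\<lambda>n. L (w n) - L (z n)) \<longlonglongrightarrow> 0"
    by (simp add: dist_real_def tendsto_rabs_zero_iff)
  then have Lz_lim: "(\<lambda>n. L (z n)) \<longlonglongrightarrow> l"
    by (rule Lim_transform2[OF L_lim])
  \<comment> \<open>\<open>infdist\<close> to \<open>A\<close> is 1-Lipschitz, so passing from
    \<open>w n\<close> to \<open>z n\<close> keeps the distance \<open>r\<close> in the
    limit.\<close>
  have iz_lim: "(\<lambda>n. infdist (z n) A) \<longlonglongrightarrow> r"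
  proof (rule metric_tendsto_imp_tendsto[OF wz_lim], rule always_eventually, rule allI)
    fix n
    have "\<bar>infdist (z n) A - infdist (w n) A\<bar> \<le> dist (w n) (z n)"
      using infdist_triangle_abs[of "z n" A "w n"] by (simp add: dist_commute)
    then show "dist (infdist (z n) A) r \<le> dist (dist (w n) (z n)) 0"
      using s[of n] by (simp add: w_def dist_real_def)
  qed
  have "eventually (\<lambda>n. c * (infdist (z n) A)\<^sup>2 \<le> L (z n) - l) sequentially"
    using order_tendstoD(2)[OF iz_lim r(3)]
  proof eventually_elim
    case (elim n)
    then obtain a where "a \<in> A" "dist (z n) a < \<eta>"
      using infdist_lessD[of A "z n" \<eta>] u by auto
    then show ?case
      using coercive[OF _ z, of a n] L_orbit[of a] by (simp add: dist_commute)
  qed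
  \<comment> \<open>The coercivity bound at \<open>z n\<close>, passed to the limit.\<close>
  then have "c * r\<^sup>2 \<le> l - l"
    by (intro tendsto_le[OF _ tendsto_diff[OF Lz_lim tendsto_const]
          tendsto_mult[OF tendsto_const tendsto_power[OF iz_lim]]]) auto
  moreover have "0 < c * r\<^sup>2"
    using pos r by simp
  ultimately show False
    by simp
qed

section \<open>Application to the orbit of the relative equilibrium\<close>

theorem theorem8p5:
  fixes D :: "'e::banach set"
    and X :: "'e \<Rightarrow> 'e"
    and \<Phi> :: "real \<Rightarrow> 'e \<Rightarrow> 'e"
    and F :: "'e \<Rightarrow> real ^ 'm"
    and \<phi> :: "'g::topological_group_add \<Rightarrow> 'e \<Rightarrow> 'e"
    and \<mu> :: "real ^ 'm"
    and u\<^sub>\<mu> :: 'e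
    and L :: "'e \<Rightarrow> real"
    and \<eta> c :: real
  defines "\<Sigma> \<equiv> level_set F \<mu>"
  defines "G\<^sub>\<Sigma> \<equiv> set_stabilizer \<phi> \<Sigma>"
  defines "\<O> \<equiv> orbit \<phi> G\<^sub>\<Sigma> u\<^sub>\<mu>"
  assumes "dynamical_system D X \<Phi>"
    and "C2_function F"
    and "constant_of_motion \<Phi> F"
    and "invariance_group \<phi> \<Phi>"
    and "u\<^sub>\<mu> \<in> \<Sigma>"
    and "relative_equilibrium \<phi> G\<^sub>\<Sigma> \<Phi> u\<^sub>\<mu>"
    and "continuous_on UNIV L"
    and "constant_of_motion \<Phi> L"
    and "\<forall>g\<in>G\<^sub>\<Sigma>. L \<circ> \<phi> g = L"
    and "\<eta> > 0" and "c > 0"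
    and "\<forall>u\<in>\<O>. \<forall>u'\<in>\<Sigma>. dist u u' \<le> \<eta> \<longrightarrow> L u' - L u \<ge> c * (infdist u' \<O>)\<^sup>2"
  shows "(\<forall>u\<in>\<O>. \<forall>\<epsilon>>0. \<exists>\<delta>>0. \<forall>u'\<in>\<Sigma>. dist u' u \<le> \<delta> \<longrightarrow>
            (SUP t. ereal (infdist (\<Phi> t u') \<O>)) \<le> ereal \<epsilon>)
       \<and> ((\<forall>B. bounded B \<longrightarrow> uniformly_continuous_on B L) \<longrightarrow>
          bounded \<O> \<longrightarrow>
          (\<forall>w :: nat \<Rightarrow> 'e. bounded (range w) \<longrightarrow> (\<lambda>n. F (w n)) \<longlonglongrightarrow> \<mu> \<longrightarrow>
             (\<lambda>n. infdist (w n) \<Sigma>) \<longlonglongrightarrow> 0) \<longrightarrow>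
          (\<forall>u\<in>\<O>. relative_equilibrium \<phi> G\<^sub>\<Sigma> \<Phi> u \<and> orbitally_stable \<phi> G\<^sub>\<Sigma> \<Phi> u))"
proof -
  note dyn = assms(4) and C2 = assms(5) and F_com = assms(6) and inv = assms(7)
    and u_level = assms(8) and releq = assms(9) and L_cont = assms(10) and L_com = assms(11)
    and L_inv = assms(12) and pos = assms(13,14) and coercive = assms(15)
  have zero: "\<Phi> 0 = id" and cont: "\<And>x. continuous_on UNIV (\<lambda>t. \<Phi> t x)"
    using dyn by (auto simp: dynamical_system_def)
  have F_cont: "continuous_on UNIV F"
    using C2 unfolding C2_function_def
    by (auto intro!: continuous_at_imp_continuous_on dest: has_derivative_continuous)
  have F_const: "F (\<Phi> t x) = F x" and L_const: "L (\<Phi> t x) = L x" for t x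
    using F_com L_com unfolding constant_of_motion_def by (metis comp_apply)+
  have act: "topological_action \<phi>"
    using inv by (simp add: invariance_group_def)
  have L_orbit: "L x = L u\<^sub>\<mu>" if "x \<in> \<O>" for x
    using that L_inv by (auto simp: \<O>_def orbit_def fun_eq_iff)
  have level: "\<O> \<subseteq> \<Sigma>"
    using u_level by (auto simp: \<O>_def orbit_def G\<^sub>\<Sigma>_def set_stabilizer_def)
  have coer: "c * (infdist y \<O>)\<^sup>2 \<le> L y - L x"
    if "x \<in> \<O>" "y \<in> \<Sigma>" "dist x y \<le> \<eta>" for x y
    using that coercive by blast
  have releq_orbit: "relative_equilibrium \<phi> G\<^sub>\<Sigma> \<Phi> u" if "u \<in> \<O>" for u
    using relative_equilibrium_orbit[OF inv] releq that by (simp add: \<O>_def G\<^sub>\<Sigma>_def)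
  show ?thesis
  proof (intro conjI ballI allI impI)
    fix u and \<epsilon> :: real
    assume "u \<in> \<O>" "0 < \<epsilon>"
    \<comment> \<open>The premise left open in the rule is invariance of \<Sigma> under the flow,
      which holds because \<open>F\<close> is conserved.\<close>
    have "\<exists>\<delta>>0. \<forall>v\<in>\<Sigma>. dist v u \<le> \<delta> \<longrightarrow> (\<forall>t. infdist (\<Phi> t v) \<O> \<le> \<epsilon>)"
      by (rule stable_within_level_set[where L = L, OF zero cont _ L_cont L_const L_orbit pos coer])
        (use \<open>u \<in> \<O>\<close> \<open>0 < \<epsilon>\<close> F_const in \<open>auto simp: \<Sigma>_def level_set_def\<close>)
    then show "\<exists>\<delta>>0. \<forall>u'\<in>\<Sigma>. dist u' u \<le> \<delta> \<longrightarrow> (SUP t. ereal (infdist (\<Phi> t u') \<O>)) \<le> ereal \<epsilon>"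
      by (simp add: SUP_le_iff)
  next
    fix u assume "u \<in> \<O>"
    then show "relative_equilibrium \<phi> G\<^sub>\<Sigma> \<Phi> u"
      by (rule releq_orbit)
  next
    fix u
    assume unif: "\<forall>B. bounded B \<longrightarrow> uniformly_continuous_on B L" and bdd: "bounded \<O>"
      and approach: "\<forall>w :: nat \<Rightarrow> 'e. bounded (range w) \<longrightarrow> (\<lambda>n. F (w n)) \<longlonglongrightarrow> \<mu> \<longrightarrow>
             (\<lambda>n. infdist (w n) \<Sigma>) \<longlonglongrightarrow> 0"
      and u: "u \<in> \<O>"
    have orbit_eq: "orbit \<phi> G\<^sub>\<Sigma> v = \<O>" if "v \<in> \<O>" for v
      using orbit_set_stabilizer_eq[OF act] that by (simp add: \<O>_def G\<^sub>\<Sigma>_def)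
    have "\<Phi> t u \<in> \<O>" for t
      using releq_orbit[OF u] orbit_eq[OF u] by (simp add: relative_equilibrium_def)
    \<comment> \<open>The motion of \<open>u\<close> stays in \<open>\<O>\<close>, so the infimum
      over \<open>t'\<close> in \<open>orbitally_stable\<close> is that of a constant.\<close>
    then have orbits: "orbit \<phi> G\<^sub>\<Sigma> (\<Phi> t u) = \<O>" for t
      by (rule orbit_eq)
    have "\<exists>\<delta>>0. \<forall>v. dist v u \<le> \<delta> \<longrightarrow> (\<forall>t. infdist (\<Phi> t v) \<O> \<le> \<epsilon>)" if "0 < \<epsilon>" for \<epsilon>
      by (rule stable_near_level_set[where L = L, OF zero cont F_cont F_const L_cont L_const L_orbit
            level[unfolded \<Sigma>_def] pos coer])
        (use unif bdd approach u that in \<open>auto simp: \<Sigma>_def\<close>)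
    then show "orbitally_stable \<phi> G\<^sub>\<Sigma> \<Phi> u"
      by (simp add: orbitally_stable_def orbits)
  qed
qed

end
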